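(* Let $X$, $Y$, $P$ be metric spaces, $\varphi:X\to\mathbb{R}\cup\{\pm\infty\}$ a function, $\Psi:P\times X\rightrightarrows Y$ and $\Phi:P\times X\to\mathcal{B}(Y)$ set-valued mappings. For $p\in P$ consider the problem $$(\mathcal{P}_p)\qquad\min\varphi(x)\ \text{ subject to }\ x\in\mathcal{R}(p)=\{x\in X:\Phi(p,x)\subseteq\Psi(p,x)\}.$$ Let $\bar p\in P$ and let $\bar x\in\mathcal{R}(\bar p)$ be a local minimizer of problem $(\mathcal{P}_{\bar p})$. Suppose that: (i) $(X,d)$ is metrically complete; (ii) $\varphi$ is lower semicontinuous at $\bar x$; (iii) $\mathcal{R}:P\rightrightarrows X$ is semiregular at $\bar p$, uniformly over $\mathcal{R}(\bar p)$; (iv) problem $(\mathcal{P}_{\bar p})$ is calm at $\bar p$ (with respect to the local minimizer $\bar x$); and there exists $\delta>0$ such that: (v) for each $p\in\mathrm{B}(\bar p,\delta)$, $\Psi(p,\cdot):X\rightrightarrows Y$ is Hausdorff upper semicontinuous on $X$ and set-covering on $X$ with constant $\alpha_p>0$; (vi) for each $p\in\mathrm{B}(\bar p,\delta)$, $\Phi(p,\cdot):X\to\mathcal{B}(Y)$ is Lipschitz on $X$ with constant $\beta_p\in(0,\alpha_p)$. Then there exists $l>0$ such that the penalty functional $$\varphi_l(\bar p,x)=\varphi(x)+l\cdot\operatorname{exc}(\Phi(\bar p,x),\Psi(\bar p,x)),\qquad x\in X,$$ is exact at $\bar x$, i.e. $\bar x$ is an unconstrained local minimizer of $\varphi_l(\bar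 p,\cdot)$.
   Context: Conventions: $\Phi$ and $\Psi$ have nonempty closed values at every point of $P\times X$. $\mathcal{B}(Y)$ is the collection of bounded subsets of $Y$, so $\Phi$ has bounded values. $\mathcal{R}(p)$ is not assumed nonempty for all $p$. In a metric space, $\mathrm{B}(x,r)$ is the closed ball of center $x$ and radius $r$; $\operatorname{dist}(x,S)=\inf_{z\in S}d(z,x)$, with $\operatorname{dist}(x,\varnothing)=+\infty$; $\mathrm{B}(S,r)=\{x:\operatorname{dist}(x,S)\le r\}$; $\operatorname{exc}(A,B)=\sup_{a\in A}\operatorname{dist}(a,B)$. $\bar x\in\mathcal{R}(\bar p)$ is a local minimizer of $(\mathcal{P}_{\bar p})$ if $\varphi(x)\ge\varphi(\bar x)$ for all $x\in\mathcal{R}(\bar p)$ in some ball around $\bar x$. Calmness: given a local minimizer $\bar x\in\mathcal{R}(\bar p)$ of $(\mathcal{P}_{\bar p})$, problem $(\mathcal{P}_{\bar p})$ is calm at $\bar p$ if there exist constants $r,\zeta>0$ such that $\varphi(x)\ge\varphi(\bar x)-\zeta d(p,\bar p)$ for all $p\in\mathrm{B}(\bar p,r)$ and all $x\in\mathrm{B}(\bar x,r)\cap\mathcal{R}(p)$. Semiregularity: a set-valued mapping $\Xi:P\rightrightarrows X$ is semiregular at $\bar p$, uniformly over $\Xi(\bar p)$, if there exist constants $r,\kappa>0$ such that $\operatorname{dist}(\bar p,\Xi^{-1}(x))\le\kappa\, d(x,z)$ for all $z\in\Xi(\bar p)$ and all $x\in\mathrm{B}(z,r)$, where $\Xi^{-1}(x)=\{p\in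 P:x\in\Xi(p)\}$. A set-valued mapping $\Psi:X\rightrightarrows Y$ is set-covering on $X$ with constant $\alpha>0$ if for every $x\in X$ and every $r>0$ there exists $u\in \mathrm{B}(x,r)$ such that $\mathrm{B}(\Psi(x),\alpha r)\subseteq\Psi(u)$. It is Hausdorff upper semicontinuous at $x_0$ if for every $\epsilon>0$ there exists $\delta>0$ such that $\Psi(x)\subseteq\mathrm{B}(\Psi(x_0),\epsilon)$ for every $x\in\mathrm{B}(x_0,\delta)$; on $X$ if at every $x_0\in X$. A set-valued mapping $\Phi:X\rightrightarrows Y$ is Lipschitz on $X$ with constant $\beta$ if $\operatorname{exc}(\Phi(x_1),\Phi(x_2))\le\beta\, d(x_1,x_2)$ for all $x_1,x_2\in X$. *)

theory Defs
  imports "HOL-Analysis.Analysis"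
begin

text \<open>
  The library distances \<open>infdist\<close> and \<open>setdist\<close> are real-valued and
  return 0 on the empty set. Here the distance to the empty set has to be \<open>\<infinity>\<close>, hence
  the extended-real versions below. Closed balls are the library's \<^const>\<open>cball\<close>.
\<close>

definition dist_set :: "'a::metric_space \<Rightarrow> 'a set \<Rightarrow> ereal" where
  "dist_set x S = (INF z\<in>S. ereal (dist z x))"

definition ball_set :: "'a::metric_space set \<Rightarrow> real \<Rightarrow> 'a set" where
  "ball_set S r = {x. dist_set x S \<le> ereal r}"

text \<open>
  The supremum is taken in the extended reals, so \<open>exc {} B = -\<infinity>\<close>; below, the first
  argument is always a value of a mapping whose values are assumed nonempty.
\<close>

definition exc :: "'a::metric_space set \<Rightarrow> 'a set \<Rightarrow> ereal" where
  "exc A B = (SUP a\<in>A. dist_set a B)"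

text \<open>
  A set-valued mapping from \<open>'a\<close> to \<open>'b\<close> is a function \<open>'a \<Rightarrow> 'b set\<close>; one on a product
  of \<open>'p\<close> and \<open>'x\<close> is curried, so that \<open>\<Psi> p\<close> is the partial mapping with fixed \<open>p\<close>.
\<close>

definition feasible ::
  "('p \<Rightarrow> 'x \<Rightarrow> 'y set) \<Rightarrow> ('p \<Rightarrow> 'x \<Rightarrow> 'y set) \<Rightarrow> 'p \<Rightarrow> 'x set" where
  "feasible \<Phi> \<Psi> p = {x. \<Phi> p x \<subseteq> \<Psi> p x}"

definition local_minimizer_on ::
  "'x::metric_space set \<Rightarrow> ('x \<Rightarrow> ereal) \<Rightarrow> 'x \<Rightarrow> bool" where
  "local_minimizer_on S f x0 \<longleftrightarrow>
     x0 \<in> S \<and> (\<exists>r>0. \<forall>x\<in>S \<inter> cball x0 r. f x \<ge> f x0)"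

definition lsc_at :: "'x::topological_space \<Rightarrow> ('x \<Rightarrow> ereal) \<Rightarrow> bool" where
  "lsc_at x0 f \<longleftrightarrow> f x0 \<le> Liminf (at x0) f"

definition calm_at ::
  "('x::metric_space \<Rightarrow> ereal) \<Rightarrow> ('p::metric_space \<Rightarrow> 'x set) \<Rightarrow> 'p \<Rightarrow> 'x \<Rightarrow> bool" where
  "calm_at \<phi> R p0 x0 \<longleftrightarrow>
     (\<exists>r>0. \<exists>\<zeta>>0. \<forall>p\<in>cball p0 r. \<forall>x\<in>cball x0 r \<inter> R p.
        \<phi> x \<ge> \<phi> x0 - ereal (\<zeta> * dist p p0))"

definition semiregular_at ::
  "('p::metric_space \<Rightarrow> 'x::metric_space set) \<Rightarrow> 'p \<Rightarrow> bool" where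
  "semiregular_at \<Xi> p0 \<longleftrightarrow>
     (\<exists>r>0. \<exists>\<kappa>>0. \<forall>z\<in>\<Xi> p0. \<forall>x\<in>cball z r.
        dist_set p0 {p. x \<in> \<Xi> p} \<le> ereal (\<kappa> * dist x z))"

definition set_covering ::
  "real \<Rightarrow> ('x::metric_space \<Rightarrow> 'y::metric_space set) \<Rightarrow> bool" where
  "set_covering \<alpha> \<Psi> \<longleftrightarrow>
     (\<forall>x. \<forall>r>0. \<exists>u\<in>cball x r. ball_set (\<Psi> x) (\<alpha> * r) \<subseteq> \<Psi> u)"

definition hausdorff_usc_at ::
  "'x::metric_space \<Rightarrow> ('x \<Rightarrow> 'y::metric_space set) \<Rightarrow> bool" where
  "hausdorff_usc_at x0 \<Psi> \<longleftrightarrow>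
     (\<forall>\<epsilon>>0. \<exists>\<delta>>0. \<forall>x\<in>cball x0 \<delta>. \<Psi> x \<subseteq> ball_set (\<Psi> x0) \<epsilon>)"

definition lipschitz_set_valued ::
  "real \<Rightarrow> ('x::metric_space \<Rightarrow> 'y::metric_space set) \<Rightarrow> bool" where
  "lipschitz_set_valued \<beta> \<Phi> \<longleftrightarrow>
     (\<forall>x1 x2. exc (\<Phi> x1) (\<Phi> x2) \<le> ereal (\<beta> * dist x1 x2))"

definition penalty ::
  "('x \<Rightarrow> ereal) \<Rightarrow> ('p \<Rightarrow> 'x \<Rightarrow> 'y::metric_space set) \<Rightarrow> ('p \<Rightarrow> 'x \<Rightarrow> 'y set)
     \<Rightarrow> real \<Rightarrow> 'p \<Rightarrow> 'x \<Rightarrow> ereal" where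
  "penalty \<phi> \<Phi> \<Psi> l p x = \<phi> x + ereal l * exc (\<Phi> p x) (\<Psi> p x)"

end

theory Submission
  imports Defs
begin

text \<open>
  Fix the reference parameter. A Newton-type iteration gives the error bound
  \<open>d(x, R(p0)) \<le> exc(\<Phi>(p0,x), \<Psi>(p0,x)) / (\<alpha> - \<beta>)\<close>: if \<open>\<Phi>(x)\<close> lies in the \<open>e\<close>-enlargement
  of \<open>\<Psi>(x)\<close>, set-covering provides \<open>u\<close> with \<open>d(x,u) \<le> e/\<alpha>\<close> and \<open>\<Phi>(x) \<subseteq> \<Psi>(u)\<close>, and since
  \<open>\<Phi>\<close> is \<open>\<beta>\<close>-Lipschitz, \<open>\<Phi>(u)\<close> lies in the \<open>(\<beta>/\<alpha>)e\<close>-enlargement of \<open>\<Psi>(u)\<close>. Repeating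
  this, the excess and the step lengths decay geometrically with ratio \<open>\<beta>/\<alpha> < 1\<close>; the limit is
  feasible by upper semicontinuity and closedness of the values of \<open>\<Psi>\<close>
  (\<open>covering_error_bound\<close>).

  Semiregularity turns a feasible point near \<open>x\<close> into a parameter \<open>p\<close> with \<open>x \<in> R(p)\<close> and
  \<open>d(p,p0)\<close> bounded by essentially \<open>\<kappa> d(x, R(p0))\<close>, and calmness then bounds the decrease of
  the objective at \<open>x\<close> by \<open>\<zeta> d(p,p0)\<close>. Combining the three estimates, the decrease is dominated
  by a multiple of the excess, which is exactness of the penalty. The distance
  from \<open>p0\<close> to the set of such \<open>p\<close> need not be attained; a factor 2 in the penalty parameter
  absorbs this.
\<close>

section \<open>Extended-real distances and excess\<close>

lemma dist_set_less_iff: "dist_set x S < ereal t \<longleftrightarrow> (\<exists>z\<in>S. dist z x < t)"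
  by (simp add: dist_set_def INF_less_iff)

lemma dist_set_nonneg: "0 \<le> dist_set x S"
  by (auto simp: dist_set_def intro!: INF_greatest)

lemma dist_set_eq_0: "x \<in> S \<Longrightarrow> dist_set x S = 0"
  by (rule antisym[OF _ dist_set_nonneg])
     (auto simp: dist_set_def zero_ereal_def intro!: INF_lower2[of x])

lemma exc_le_iff: "exc A B \<le> ereal t \<longleftrightarrow> A \<subseteq> ball_set B t"
  by (auto simp: exc_def ball_set_def SUP_le_iff)

lemma exc_nonneg:
  assumes "A \<noteq> {}"
  shows "0 \<le> exc A B"
proof -
  obtain a where "a \<in> A" using assms by blast
  then have "dist_set a B \<le> exc A B" by (auto simp: exc_def intro: SUP_upper)
  then show ?thesis using dist_set_nonneg order_trans by blast
qed

lemma exc_subset_le_0: "A \<subseteq> B \<Longrightarrow> exc A B \<le> 0"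
  by (auto simp: exc_def dist_set_eq_0 intro!: SUP_least)

lemma exc_le_0_imp_subset:
  assumes "exc A B \<le> 0" and "closed B"
  shows "A \<subseteq> B"
proof
  fix a assume "a \<in> A"
  then have "dist_set a B \<le> exc A B" by (auto simp: exc_def intro: SUP_upper)
  then have "dist_set a B \<le> 0" using assms(1) by (rule order_trans)
  then have "dist_set a B < ereal e" if "e > 0" for e
    using that by (metis ereal_less(2) le_less_trans)
  then have "a \<in> closure B"
    by (simp add: closure_approachable dist_set_less_iff)
  then show "a \<in> B" using assms(2) by simp
qed

lemma ball_set_approx:
  assumes "w \<in> ball_set S r" and "r < t"
  obtains z where "z \<in> S" and "dist z w < t"
proof -
  have "dist_set w S < ereal t"
    using assms by (auto simp: ball_set_def intro: le_less_trans)
  then show ?thesis using that by (auto simp: dist_set_less_iff)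
qed

lemma lipschitz_set_valuedD:
  assumes "lipschitz_set_valued \<beta> F"
  shows "F x \<subseteq> ball_set (F y) (\<beta> * dist x y)"
  using assms by (simp add: lipschitz_set_valued_def flip: exc_le_iff)

section \<open>Sequences with geometrically decaying steps\<close>

lemma dist_le_geometric:
  fixes X :: "nat \<Rightarrow> 'a::metric_space"
  assumes step: "\<And>n. dist (X n) (X (Suc n)) \<le> c * q ^ n"
    and q: "0 < q" "q < 1" and c: "0 \<le> c"
  shows "dist (X n) (X (n + k)) \<le> c * q ^ n / (1 - q)"
proof -
  have "dist (X n) (X (n + k)) \<le> c * q ^ n * (1 - q ^ k) / (1 - q)"
  proof (induction k)
    case (Suc k)
    have "dist (X n) (X (n + Suc k)) \<le> dist (X n) (X (n + k)) + dist (X (n + k)) (X (Suc (n + k)))"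
      using dist_triangle[of "X n" "X (n + Suc k)" "X (n + k)"] by simp
    also have "\<dots> \<le> c * q ^ n * (1 - q ^ k) / (1 - q) + c * q ^ (n + k)"
      using Suc step[of "n + k"] by simp
    also have "\<dots> = c * q ^ n * (1 - q ^ Suc k) / (1 - q)"
      using q by (simp add: field_simps power_add)
    finally show ?case .
  qed simp
  also have "\<dots> \<le> c * q ^ n / (1 - q)"
    using q c by (intro divide_right_mono) (auto simp: mult_left_le)
  finally show ?thesis .
qed

lemma complete_geometric_convergent:
  fixes X :: "nat \<Rightarrow> 'a::metric_space"
  assumes step: "\<And>n. dist (X n) (X (Suc n)) \<le> c * q ^ n"
    and q: "0 < q" "q < 1" and c: "0 \<le> c"
    and complete: "complete (UNIV :: 'a set)"
  obtains l where "X \<longlonglongrightarrow> l" and "dist (X 0) l \<le> c / (1 - q)"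
proof -
  note bound = dist_le_geometric[of X, OF step q c]
  have "(\<lambda>n. c * q ^ n / (1 - q)) \<longlonglongrightarrow> c * 0 / (1 - q)"
    by (intro tendsto_intros LIMSEQ_power_zero) (use q in auto)
  then have lim: "(\<lambda>n. c * q ^ n / (1 - q)) \<longlonglongrightarrow> 0" by simp
  have "Cauchy X"
  proof (rule metric_CauchyI)
    fix e :: real assume "e > 0"
    then have "eventually (\<lambda>n. c * q ^ n / (1 - q) < e / 2) sequentially"
      using lim by (intro order_tendstoD(2)) auto
    then obtain N where N: "c * q ^ N / (1 - q) < e / 2"
      by (auto simp: eventually_sequentially)
    have "dist (X m) (X n) < e" if "N \<le> m" "N \<le> n" for m n
    proof -
      have "dist (X N) (X m) < e / 2" "dist (X N) (X n) < e / 2"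
        using le_less_trans[OF bound[of N "m - N"] N] le_less_trans[OF bound[of N "n - N"] N]
          that by (simp_all del: less_divide_eq_numeral1)
      then show ?thesis using dist_triangle3[of "X m" "X n" "X N"] by linarith
    qed
    then show "\<exists>M. \<forall>m\<ge>M. \<forall>n\<ge>M. dist (X m) (X n) < e" by blast
  qed
  then obtain l where l: "X \<longlonglongrightarrow> l"
    using complete by (auto simp: complete_def)
  have "(\<lambda>n. dist (X 0) (X n)) \<longlonglongrightarrow> dist (X 0) l"
    by (intro tendsto_intros l)
  then have "dist (X 0) l \<le> c / (1 - q)"
    by (rule LIMSEQ_le_const2) (use bound[of 0] in auto)
  with l show ?thesis by (rule that)
qed

section \<open>The error bound for a Lipschitz and a set-covering mapping\<close>

lemma covering_step:
  assumes cov: "set_covering \<alpha> G" and lip: "lipschitz_set_valued \<beta> F"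
    and \<alpha>: "0 < \<alpha>" and \<beta>: "0 \<le> \<beta>" and e: "0 < e"
    and sub: "F x \<subseteq> ball_set (G x) e"
  obtains u where "dist x u \<le> e / \<alpha>" and "F x \<subseteq> G u" and "F u \<subseteq> ball_set (G u) (\<beta> / \<alpha> * e)"
proof -
  have "e / \<alpha> > 0" using e \<alpha> by simp
  then obtain u where u: "u \<in> cball x (e / \<alpha>)" and "ball_set (G x) (\<alpha> * (e / \<alpha>)) \<subseteq> G u"
    using cov unfolding set_covering_def by blast
  with sub \<alpha> have FG: "F x \<subseteq> G u" by auto
  have du: "dist x u \<le> e / \<alpha>" using u by simp
  have le: "\<beta> * dist u x \<le> \<beta> / \<alpha> * e"
    using mult_left_mono[OF du \<beta>] by (simp add: dist_commute)
  have "dist_set y (G u) \<le> ereal (\<beta> / \<alpha> * e)" if "y \<in> F u" for y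
  proof -
    have "dist_set y (G u) \<le> dist_set y (F x)"
      unfolding dist_set_def using FG by (rule INF_superset_mono) simp
    also have "\<dots> \<le> ereal (\<beta> * dist u x)"
      using lipschitz_set_valuedD[OF lip, of u x] that by (auto simp: ball_set_def)
    also have "\<dots> \<le> ereal (\<beta> / \<alpha> * e)" using le by simp
    finally show ?thesis .
  qed
  then have "F u \<subseteq> ball_set (G u) (\<beta> / \<alpha> * e)" by (auto simp: ball_set_def)
  with du FG show ?thesis by (rule that)
qed

text \<open>
  Successive inclusions \<open>F (X n) \<subseteq> G (X (n + 1))\<close> pass to the limit as \<open>F l \<subseteq> G l\<close>: points of
  \<open>F l\<close> are close to \<open>F (X n)\<close>, and points of \<open>G (X (n + 1))\<close> are close to \<open>G l\<close>.
\<close>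

lemma shifted_inclusion_limit:
  assumes X: "X \<longlonglongrightarrow> l" and incl: "\<And>n. F (X n) \<subseteq> G (X (Suc n))"
    and lip: "lipschitz_set_valued \<beta> F" and usc: "hausdorff_usc_at l G" and cl: "closed (G l)"
  shows "F l \<subseteq> G l"
proof
  fix y assume y: "y \<in> F l"
  have "\<exists>z\<in>G l. dist z y < e" if e: "e > 0" for e
  proof -
    obtain d where d: "d > 0" and G: "\<And>x. x \<in> cball l d \<Longrightarrow> G x \<subseteq> ball_set (G l) (e / 4)"
      using usc e unfolding hausdorff_usc_at_def by (metis zero_less_divide_iff zero_less_numeral)
    have "(\<lambda>n. \<beta> * dist l (X n)) \<longlonglongrightarrow> \<beta> * dist l l"
      by (intro tendsto_intros X)
    then have "eventually (\<lambda>n. \<beta> * dist l (X n) < e / 2) sequentially"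
      using e by (intro order_tendstoD(2)) auto
    moreover have "eventually (\<lambda>n. dist (X (Suc n)) l < d) sequentially"
      using tendstoD[OF LIMSEQ_Suc[OF X] d] .
    ultimately have "eventually (\<lambda>n. \<beta> * dist l (X n) < e / 2 \<and> dist (X (Suc n)) l < d) sequentially"
      by (rule eventually_conj)
    then obtain n where n: "\<beta> * dist l (X n) < e / 2" "dist (X (Suc n)) l < d"
      by (auto simp: eventually_sequentially)
    have "y \<in> ball_set (F (X n)) (\<beta> * dist l (X n))"
      using lipschitz_set_valuedD[OF lip] y by blast
    then obtain w where w: "w \<in> F (X n)" "dist w y < e / 2"
      using n(1) by (rule ball_set_approx)
    have "w \<in> ball_set (G l) (e / 4)"
      using w(1) incl G[of "X (Suc n)"] n(2) by (auto simp: dist_commute)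
    moreover have "e / 4 < e / 2" using e by simp
    ultimately obtain z where "z \<in> G l" "dist z w < e / 2"
      by (rule ball_set_approx)
    moreover have "dist z y \<le> dist z w + dist w y" by (rule dist_triangle)
    ultimately show ?thesis using w(2) by (intro bexI[of _ z]) auto
  qed
  then have "y \<in> closure (G l)" by (simp add: closure_approachable)
  then show "y \<in> G l" using cl by simp
qed

lemma covering_error_bound:
  fixes F G :: "'x::metric_space \<Rightarrow> 'y::metric_space set"
  assumes complete: "complete (UNIV :: 'x set)"
    and cov: "set_covering \<alpha> G" and usc: "\<And>x. hausdorff_usc_at x G" and cl: "\<And>x. closed (G x)"
    and lip: "lipschitz_set_valued \<beta> F" and \<beta>: "0 < \<beta>" "\<beta> < \<alpha>"
    and e: "0 < e" and sub: "F x \<subseteq> ball_set (G x) e"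
  obtains z where "F z \<subseteq> G z" and "dist x z \<le> e / (\<alpha> - \<beta>)"
proof -
  define q where "q = \<beta> / \<alpha>"
  have \<alpha>: "0 < \<alpha>" and q: "0 < q" "q < 1" using \<beta> by (auto simp: q_def)
  define good where "good n u \<longleftrightarrow> F u \<subseteq> ball_set (G u) (e * q ^ n)" for n u
  have "\<exists>v. good (Suc n) v \<and> dist u v \<le> e * q ^ n / \<alpha> \<and> F u \<subseteq> G v" if "good n u" for n u
  proof -
    have "e * q ^ n > 0" using e q by simp
    from covering_step[OF cov lip \<alpha> _ this] that obtain v where
      "dist u v \<le> e * q ^ n / \<alpha>" "F u \<subseteq> G v" "F v \<subseteq> ball_set (G v) (\<beta> / \<alpha> * (e * q ^ n))"
      using \<beta> by (auto simp: good_def)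
    then show ?thesis by (auto simp: good_def q_def mult_ac)
  qed
  then have "\<forall>n u. \<exists>v. good n u \<longrightarrow> good (Suc n) v \<and> dist u v \<le> e * q ^ n / \<alpha> \<and> F u \<subseteq> G v"
    by blast
  then obtain next_point where next_point: "\<And>n u. good n u \<Longrightarrow>
      good (Suc n) (next_point n u) \<and> dist u (next_point n u) \<le> e * q ^ n / \<alpha>
        \<and> F u \<subseteq> G (next_point n u)"
    by metis
  define X where "X = rec_nat x next_point"
  have X_simps: "X 0 = x" "\<And>n. X (Suc n) = next_point n (X n)" by (simp_all add: X_def)
  have "good n (X n)" for n
  proof (induction n)
    case 0
    show ?case using sub by (simp add: X_simps good_def)
  next
    case (Suc n)
    then show ?case using next_point by (simp add: X_simps)
  qed
  then have X: "dist (X n) (X (Suc n)) \<le> e / \<alpha> * q ^ n" "F (X n) \<subseteq> G (X (Suc n))" for n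
    using next_point[of n "X n"] by (simp_all add: X_simps)
  have "0 \<le> e / \<alpha>" using e \<alpha> by simp
  with X(1) q obtain z where z: "X \<longlonglongrightarrow> z" "dist (X 0) z \<le> e / \<alpha> / (1 - q)"
    using complete by (rule complete_geometric_convergent)
  have "F z \<subseteq> G z" using z(1) X(2) lip usc cl by (rule shifted_inclusion_limit)
  moreover have "e / \<alpha> / (1 - q) = e / (\<alpha> - \<beta>)"
    using \<alpha> by (simp add: q_def right_diff_distrib)
  ultimately show ?thesis using z(2) that[of z] by (simp only: X_simps)
qed

section \<open>Exactness of the penalty\<close>

text \<open>
  Semiregularity and calmness together: the objective decreases from \<open>\<phi> x0\<close> by at most \<open>\<zeta> t\<close> at
  a point \<open>x\<close> near \<open>x0\<close> whenever \<open>t / \<kappa>\<close> strictly exceeds the distance from \<open>x\<close> to some feasible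
  point \<open>z\<close>. The point \<open>z\<close> may be farther from \<open>x\<close> than \<open>x0\<close> is, beyond the
  radius of semiregularity; then \<open>x0\<close> takes its place. The objective may be infinite at \<open>x0\<close>.
\<close>

lemma calm_semiregular_lower_bound:
  assumes x0: "x0 \<in> R p0" and calm: "calm_at \<phi> R p0 x0" and semi: "semiregular_at R p0"
  obtains \<zeta> \<kappa> \<eta> where "\<zeta> > 0" "\<kappa> > 0" "\<eta> > 0"
    "\<And>x z t. x \<in> cball x0 \<eta> \<Longrightarrow> z \<in> R p0 \<Longrightarrow> \<kappa> * dist x z < t \<Longrightarrow> \<phi> x \<ge> \<phi> x0 - ereal (\<zeta> * t)"
proof -
  obtain r \<zeta> where r: "r > 0" and \<zeta>: "\<zeta> > 0" and
    cal: "\<And>p x. p \<in> cball p0 r \<Longrightarrow> x \<in> cball x0 r \<inter> R p \<Longrightarrow> \<phi> x \<ge> \<phi> x0 - ereal (\<zeta> * dist p p0)"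
    using calm unfolding calm_at_def by blast
  obtain s \<kappa> where s: "s > 0" and \<kappa>: "\<kappa> > 0" and
    sem: "\<And>z x. z \<in> R p0 \<Longrightarrow> x \<in> cball z s \<Longrightarrow> dist_set p0 {p. x \<in> R p} \<le> ereal (\<kappa> * dist x z)"
    using semi unfolding semiregular_at_def by blast
  \<comment> \<open>The third bound ensures that the parameter found below lies within the calmness radius \<open>r\<close>.\<close>
  define \<eta> where "\<eta> = min r (min s (r / (2 * \<kappa>)))"
  have \<eta>: "\<eta> > 0" "\<eta> \<le> r" "\<eta> \<le> s" using r s \<kappa> by (auto simp: \<eta>_def)
  have "\<kappa> * \<eta> \<le> \<kappa> * (r / (2 * \<kappa>))" using \<kappa> by (intro mult_left_mono) (auto simp: \<eta>_def)
  then have \<kappa>\<eta>: "\<kappa> * \<eta> < r" using r \<kappa> by simp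
  have "\<phi> x \<ge> \<phi> x0 - ereal (\<zeta> * t)"
    if x: "x \<in> cball x0 \<eta>" and z: "z \<in> R p0" and t: "\<kappa> * dist x z < t" for x z t
  proof -
    define z' where "z' = (if dist x z \<le> dist x x0 then z else x0)"
    have z': "z' \<in> R p0" "dist x z' \<le> dist x x0" "dist x z' \<le> dist x z"
      using x0 z by (auto simp: z'_def)
    have dx: "dist x z' \<le> \<eta>" using z'(2) x by (simp add: dist_commute)
    then have "\<kappa> * dist x z' \<le> \<kappa> * \<eta>" "\<kappa> * dist x z' \<le> \<kappa> * dist x z"
      using \<kappa> z'(3) by simp_all
    then have lt: "\<kappa> * dist x z' < min t r" using t \<kappa>\<eta> by linarith
    have "x \<in> cball z' s" using dx \<eta>(3) by (simp add: dist_commute)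
    with sem z'(1) have "dist_set p0 {p. x \<in> R p} \<le> ereal (\<kappa> * dist x z')" by blast
    also have "\<dots> < ereal (min t r)" using lt by simp
    finally obtain p where p: "x \<in> R p" "dist p p0 < min t r"
      unfolding dist_set_less_iff by blast
    have "\<phi> x0 - ereal (\<zeta> * t) \<le> \<phi> x0 - ereal (\<zeta> * dist p p0)"
      using \<zeta> p(2) by (intro ereal_minus_mono) auto
    also have "\<dots> \<le> \<phi> x"
      using p x \<eta>(2) by (intro cal) (auto simp: dist_commute)
    finally show ?thesis .
  qed
  with \<zeta> \<kappa> \<eta>(1) show ?thesis by (rule that)
qed


theorem theorem3p12:
  fixes \<phi> :: "'x::metric_space \<Rightarrow> ereal"
    and \<Phi> \<Psi> :: "'p::metric_space \<Rightarrow> 'x \<Rightarrow> 'y::metric_space set"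
    and p0 :: 'p and x0 :: 'x
    and \<alpha> \<beta> :: "'p \<Rightarrow> real" and \<delta> :: real
  assumes \<Psi>_values: "\<And>p x. \<Psi> p x \<noteq> {} \<and> closed (\<Psi> p x)"
    and \<Phi>_values: "\<And>p x. \<Phi> p x \<noteq> {} \<and> closed (\<Phi> p x) \<and> bounded (\<Phi> p x)"
    and minimizer: "local_minimizer_on (feasible \<Phi> \<Psi> p0) \<phi> x0"
    and i: "complete (UNIV :: 'x set)"
    and ii: "lsc_at x0 \<phi>"
    and iii: "semiregular_at (feasible \<Phi> \<Psi>) p0"
    and iv: "calm_at \<phi> (feasible \<Phi> \<Psi>) p0 x0"
    and \<delta>: "\<delta> > 0"
    and v: "\<And>p. p \<in> cball p0 \<delta> \<Longrightarrow>
              (\<forall>x. hausdorff_usc_at x (\<Psi> p)) \<and> 0 < \<alpha> p \<and> set_covering (\<alpha> p) (\<Psi> p)"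
    and vi: "\<And>p. p \<in> cball p0 \<delta> \<Longrightarrow>
              0 < \<beta> p \<and> \<beta> p < \<alpha> p \<and> lipschitz_set_valued (\<beta> p) (\<Phi> p)"
  shows "\<exists>l>0. local_minimizer_on UNIV (penalty \<phi> \<Phi> \<Psi> l p0) x0"
proof -
  let ?R = "feasible \<Phi> \<Psi>" and ?F = "\<Phi> p0" and ?G = "\<Psi> p0"
  have p0: "p0 \<in> cball p0 \<delta>" using \<delta> by simp
  note v0 = v[OF p0] and vi0 = vi[OF p0]
  define c where "c = \<alpha> p0 - \<beta> p0"
  have c: "c > 0" using vi0 by (simp add: c_def)
  obtain \<rho> where x0: "x0 \<in> ?R p0" and \<rho>: "\<rho> > 0"
    and loc: "\<And>x. x \<in> ?R p0 \<inter> cball x0 \<rho> \<Longrightarrow> \<phi> x \<ge> \<phi> x0"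
    using minimizer unfolding local_minimizer_on_def by blast
  obtain \<zeta> \<kappa> \<eta> where pos: "\<zeta> > 0" "\<kappa> > 0" "\<eta> > 0" and
    low: "\<And>x z t. x \<in> cball x0 \<eta> \<Longrightarrow> z \<in> ?R p0 \<Longrightarrow> \<kappa> * dist x z < t \<Longrightarrow> \<phi> x \<ge> \<phi> x0 - ereal (\<zeta> * t)"
    using calm_semiregular_lower_bound[OF x0 iv iii] by metis
  define l where "l = \<zeta> * (2 * \<kappa> / c)"
  have l: "l > 0" using pos c by (simp add: l_def)
  have "exc (?F x0) (?G x0) = 0"
    using x0 \<Phi>_values by (intro antisym exc_nonneg exc_subset_le_0) (auto simp: feasible_def)
  then have pen0: "penalty \<phi> \<Phi> \<Psi> l p0 x0 = \<phi> x0" by (simp add: penalty_def)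
  have "penalty \<phi> \<Phi> \<Psi> l p0 x \<ge> \<phi> x0" if x: "x \<in> cball x0 (min \<rho> \<eta>)" for x
  proof -
    have nonneg: "0 \<le> exc (?F x) (?G x)" using \<Phi>_values by (intro exc_nonneg) auto
    consider (infinite) "exc (?F x) (?G x) = \<infinity>" | (zero) "exc (?F x) (?G x) = 0"
      | (pos) e where "exc (?F x) (?G x) = ereal e" "e > 0"
      using nonneg by (cases "exc (?F x) (?G x)") (auto simp: zero_ereal_def le_less)
    then show ?thesis
    proof cases
      case infinite
      \<comment> \<open>This covers \<open>\<phi> x = -\<infinity>\<close>, since \<open>-\<infinity> + \<infinity> = \<infinity>\<close> in \<^typ>\<open>ereal\<close>.\<close>
      then show ?thesis using l by (simp add: penalty_def)
    next
      case zero
      then have "?F x \<subseteq> ?G x" using \<Psi>_values by (intro exc_le_0_imp_subset) auto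
      then show ?thesis using loc[of x] x zero by (simp add: feasible_def penalty_def)
    next
      case (pos e)
      then have "?F x \<subseteq> ball_set (?G x) e" by (simp flip: exc_le_iff)
      then obtain z where z: "?F z \<subseteq> ?G z" "dist x z \<le> e / c"
        using covering_error_bound[OF i, of "\<alpha> p0" ?G "\<beta> p0" ?F e x] v0 vi0 \<Psi>_values \<open>e > 0\<close>
        unfolding c_def by metis
      have "\<kappa> * dist x z \<le> \<kappa> * (e / c)"
        using z(2) \<open>\<kappa> > 0\<close> by (intro mult_left_mono) auto
      also have "\<dots> < 2 * \<kappa> * (e / c)"
        using \<open>\<kappa> > 0\<close> \<open>e > 0\<close> c by (intro mult_strict_right_mono) auto
      finally have "\<phi> x \<ge> \<phi> x0 - ereal (\<zeta> * (2 * \<kappa> * (e / c)))"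
        using x z(1) by (intro low[of x z]) (auto simp: feasible_def)
      also have "\<zeta> * (2 * \<kappa> * (e / c)) = l * e" by (simp add: l_def)
      finally have "\<phi> x + ereal (l * e) \<ge> \<phi> x0" by (simp add: ereal_minus_le)
      then show ?thesis using pos by (simp add: penalty_def)
    qed
  qed
  then have "local_minimizer_on UNIV (penalty \<phi> \<Phi> \<Psi> l p0) x0"
    unfolding local_minimizer_on_def pen0 using \<rho> \<open>\<eta> > 0\<close>
    by (intro conjI exI[of _ "min \<rho> \<eta>"]) auto
  with l show ?thesis by blast
qed

end
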